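(* Let $\mathcal{H}$ be a complex Hilbert space and $B,C\in\mathcal{B}(\mathcal{H})$. Then $$w^2\left(\begin{bmatrix}0 & B\\ C & 0\end{bmatrix}\right)\le \frac14\max\left\{\big\||B|^2+|C^*|^2\big\|,\ \big\||B^*|^2+|C|^2\big\|\right\}+\frac12\max\left\{w(|B||C^*|),\,w(|C||B^*|)\right\}.$$
   Context: $\mathcal{B}(\mathcal{H})$ is the algebra of bounded linear operators on $\mathcal{H}$ with operator norm $\|\cdot\|$. For $A\in\mathcal{B}(\mathcal{H})$, $A^*$ is the adjoint, $|A|=(A^*A)^{1/2}$, $|A^*|=(AA^* )^{1/2}$, and $w(A)=\sup_{\|x\|=1}|\langle Ax,x\rangle|$ is the numerical radius. The operator matrix $\begin{bmatrix}A&B\\C&D\end{bmatrix}$ acts on $\mathcal{H}\oplus\mathcal{H}$ by $(x_1,x_2)\mapsto(Ax_1+Bx_2,\,Cx_1+Dx_2)$; $0$ denotes the zero operator. *)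

theory Defs
  imports "HOL-Analysis.Analysis"
begin

class complex_vector = real_vector +
  fixes scaleC :: "complex \<Rightarrow> 'a \<Rightarrow> 'a"
  assumes scaleC_add_right: "scaleC a (x + y) = scaleC a x + scaleC a y"
    and scaleC_add_left: "scaleC (a + b) x = scaleC a x + scaleC b x"
    and scaleC_scaleC: "scaleC a (scaleC b x) = scaleC (a * b) x"
    and scaleC_one: "scaleC 1 x = x"
    and scaleR_scaleC: "scaleR r x = scaleC (complex_of_real r) x"

class complex_inner = complex_vector + real_normed_vector +
  fixes cinner :: "'a \<Rightarrow> 'a \<Rightarrow> complex"
  assumes cinner_commute: "cinner x y = cnj (cinner y x)"
    and cinner_add_left: "cinner (x + y) z = cinner x z + cinner y z"
    and cinner_scaleC_left: "cinner (scaleC r x) y = r * cinner x y"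
    and cinner_self_real: "Im (cinner x x) = 0"
    and cinner_self_nonneg: "0 \<le> Re (cinner x x)"
    and cinner_self_eq_zero: "cinner x x = 0 \<longleftrightarrow> x = 0"
    and norm_eq_sqrt_cinner: "norm x = sqrt (Re (cinner x x))"

class chilbert_space = complex_inner + complete_space

definition clinear_op :: "('a::complex_vector \<Rightarrow> 'b::complex_vector) \<Rightarrow> bool" where
  "clinear_op f \<longleftrightarrow> (\<forall>x y. f (x + y) = f x + f y) \<and> (\<forall>c x. f (scaleC c x) = scaleC c (f x))"

definition bounded_op :: "('a::chilbert_space \<Rightarrow> 'a) \<Rightarrow> bool" where
  "bounded_op f \<longleftrightarrow> clinear_op f \<and> (\<exists>K. \<forall>x. norm (f x) \<le> norm x * K)"

definition adj :: "('a::chilbert_space \<Rightarrow> 'a) \<Rightarrow> ('a \<Rightarrow> 'a)" where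
  "adj A = (THE A'. bounded_op A' \<and> (\<forall>x y. cinner (A x) y = cinner x (A' y)))"

definition positive_op :: "('a::chilbert_space \<Rightarrow> 'a) \<Rightarrow> bool" where
  "positive_op S \<longleftrightarrow> bounded_op S \<and> (\<forall>x. Im (cinner (S x) x) = 0 \<and> 0 \<le> Re (cinner (S x) x))"

definition op_sqrt :: "('a::chilbert_space \<Rightarrow> 'a) \<Rightarrow> ('a \<Rightarrow> 'a)" where
  "op_sqrt P = (THE S. positive_op S \<and> S \<circ> S = P)"

definition abs_op :: "('a::chilbert_space \<Rightarrow> 'a) \<Rightarrow> ('a \<Rightarrow> 'a)" where
  "abs_op A = op_sqrt (adj A \<circ> A)"

text \<open>Numerical radius w(T) = sup over unit vectors of |<Tx,x>|
  (with the convention that the supremum is 0 on the zero space).\<close>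
definition numrad :: "('a::chilbert_space \<Rightarrow> 'a) \<Rightarrow> real" where
  "numrad T = Sup (insert 0 {cmod (cinner (T x) x) | x. norm x = 1})"

text \<open>Numerical radius of the operator matrix [A B; C D] acting on H \<oplus> H,
  with the direct-sum inner product <(x1,x2),(y1,y2)> = <x1,y1> + <x2,y2>,
  so unit vectors are pairs with norm x1^2 + norm x2^2 = 1.\<close>
definition numrad_block ::
  "('a::chilbert_space \<Rightarrow> 'a) \<Rightarrow> ('a \<Rightarrow> 'a) \<Rightarrow> ('a \<Rightarrow> 'a) \<Rightarrow> ('a \<Rightarrow> 'a) \<Rightarrow> real" where
  "numrad_block A B C D = Sup (insert 0
     {cmod (cinner (A x1 + B x2) x1 + cinner (C x1 + D x2) x2) | x1 x2.
        (norm x1)\<^sup>2 + (norm x2)\<^sup>2 = 1})"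

end

theory Submission
  imports Defs
begin

text \<open>For \<open>T\<close> the off-diagonal operator matrix, the mixed Schwarz inequality
  \<open>|\<langle>Ax, y\<rangle>|\<^sup>2 \<le> \<langle>|A|x, x\<rangle> \<langle>|A\<^sup>*|y, y\<rangle>\<close> for \<open>A = B, C\<close> gives
  \<open>|\<langle>Te, e\<rangle>|\<^sup>2 \<le> \<langle>|T|e, e\<rangle> \<langle>e, |T\<^sup>*|e\<rangle>\<close> for unit vectors \<open>e\<close>. Buzano's inequality bounds the right-hand
  side by \<open>(\<parallel>|T|e\<parallel> \<parallel>|T\<^sup>*|e\<parallel> + |\<langle>|T|e, |T\<^sup>*|e\<rangle>|) / 2\<close>, and since \<open>|T|\<close> and \<open>|T\<^sup>*|\<close> are the diagonal matrices
  with entries \<open>|C|, |B|\<close> and \<open>|B\<^sup>*|, |C\<^sup>*|\<close>, the claim follows with the arithmetic-geometric mean inequality.\<close>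

section \<open>Complex inner product spaces\<close>

lemma scaleC_minus1: "scaleC (- 1) x = - (x :: 'a::complex_vector)"
  using scaleR_scaleC[of "- 1" x] by simp

lemma scaleC_minus_right: "scaleC c (- x) = - scaleC c (x :: 'a::complex_vector)"
  by (metis scaleC_minus1 scaleC_scaleC mult.commute)

lemma scaleC_diff_right: "scaleC c (x - y) = scaleC c x - scaleC c (y :: 'a::complex_vector)"
  using scaleC_add_right[of c x "- y"] by (simp add: scaleC_minus_right)

lemma cinner_zero_left [simp]: "cinner 0 (y :: 'a::complex_inner) = 0"
  using cinner_add_left[of 0 0 y] by simp

lemma cinner_zero_right [simp]: "cinner (x :: 'a::complex_inner) 0 = 0"
  using cinner_commute[of x 0] by simp

lemma cinner_minus_left: "cinner (- x) (y :: 'a::complex_inner) = - cinner x y"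
  using cinner_add_left[of x "- x" y] by (simp add: eq_neg_iff_add_eq_0 add.commute)

lemma cinner_diff_left: "cinner (x - y) (z :: 'a::complex_inner) = cinner x z - cinner y z"
  using cinner_add_left[of x "- y" z] by (simp add: cinner_minus_left)

lemma cinner_add_right: "cinner (x :: 'a::complex_inner) (y + z) = cinner x y + cinner x z"
  by (metis cinner_commute cinner_add_left complex_cnj_add)

lemma cinner_diff_right: "cinner (x :: 'a::complex_inner) (y - z) = cinner x y - cinner x z"
  by (metis cinner_commute cinner_diff_left complex_cnj_diff)

lemma cinner_scaleC_right: "cinner (x :: 'a::complex_inner) (scaleC r y) = cnj r * cinner x y"
  by (metis cinner_commute cinner_scaleC_left complex_cnj_mult)

lemma cinner_scaleR_left: "cinner (r *\<^sub>R x) (y :: 'a::complex_inner) = of_real r * cinner x y"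
  by (simp add: scaleR_scaleC cinner_scaleC_left)

lemma cinner_scaleR_right: "cinner x (r *\<^sub>R (y :: 'a::complex_inner)) = of_real r * cinner x y"
  by (simp add: scaleR_scaleC cinner_scaleC_right)

lemma cinner_self: "cinner x x = of_real ((norm (x :: 'a::complex_inner))\<^sup>2)"
  by (simp add: norm_eq_sqrt_cinner cinner_self_nonneg complex_eq_iff cinner_self_real)

text \<open>The norm axioms only cover real scalars, so homogeneity for complex ones is read off
  from the inner product.\<close>

lemma norm_scaleC: "norm (scaleC c x) = cmod c * norm (x :: 'a::complex_inner)"
proof -
  have "of_real ((norm (scaleC c x))\<^sup>2) = c * cnj c * cinner x x"
    by (simp only: cinner_self[symmetric] cinner_scaleC_left cinner_scaleC_right mult_ac)
  also have "\<dots> = of_real ((cmod c * norm x)\<^sup>2)"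
    by (simp only: complex_norm_square[symmetric] cinner_self of_real_mult power_mult_distrib)
  finally have "(norm (scaleC c x))\<^sup>2 = (cmod c * norm x)\<^sup>2"
    by (simp only: of_real_eq_iff)
  then show ?thesis by simp
qed

lemma norm_add_sq:
  "(norm (x + y))\<^sup>2 = (norm x)\<^sup>2 + 2 * Re (cinner x y) + (norm (y :: 'a::complex_inner))\<^sup>2"
proof -
  have "(norm (x + y))\<^sup>2 = Re (cinner (x + y) (x + y))"
    by (simp add: cinner_self)
  also have "\<dots> = (norm x)\<^sup>2 + Re (cinner x y) + Re (cinner y x) + (norm y)\<^sup>2"
    unfolding cinner_add_left cinner_add_right by (simp add: cinner_self)
  finally show ?thesis
    using cinner_commute[of y x] by simp
qed

lemma norm_diff_sq:
  "(norm (x - y))\<^sup>2 = (norm x)\<^sup>2 - 2 * Re (cinner x y) + (norm (y :: 'a::complex_inner))\<^sup>2"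
  using norm_add_sq[of x "- y"] cinner_minus_left[of y x] cinner_commute[of x "- y"]
    cinner_commute[of x y]
  by simp

section \<open>Linear operators, the Cauchy-Schwarz and Buzano inequalities\<close>

lemma clinear_op_add: "clinear_op f \<Longrightarrow> f (x + y) = f x + f y"
  by (simp add: clinear_op_def)

lemma clinear_op_scaleC: "clinear_op f \<Longrightarrow> f (scaleC c x) = scaleC c (f x)"
  by (simp add: clinear_op_def)

lemma clinear_op_scaleR: "clinear_op f \<Longrightarrow> f (r *\<^sub>R x) = r *\<^sub>R f x"
  by (simp add: scaleR_scaleC clinear_op_scaleC)

lemma clinear_op_diff: "clinear_op f \<Longrightarrow> f (x - y) = f x - f y"
  by (metis clinear_op_add diff_add_cancel add_diff_cancel_right')

lemma clinear_op_id: "clinear_op (\<lambda>x. x)"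
  by (simp add: clinear_op_def)

text \<open>For a semi-definite form the usual choice of multiplier in the proof of the Cauchy-Schwarz
  inequality may be undefined, so \<open>\<langle>Py, y\<rangle>\<close> is perturbed by \<open>e > 0\<close>.\<close>

lemma semidefinite_Cauchy_Schwarz:
  fixes P :: "'a::complex_inner \<Rightarrow> 'a"
  assumes lin: "clinear_op P" and sym: "\<And>x y. cinner (P x) y = cinner x (P y)"
    and nonneg: "\<And>x. 0 \<le> Re (cinner (P x) x)"
  shows "(cmod (cinner (P x) y))\<^sup>2 \<le> Re (cinner (P x) x) * Re (cinner (P y) y)"
proof -
  define m where "m = cinner (P x) y"
  define a where "a = Re (cinner (P x) x)"
  define b where "b = Re (cinner (P y) y)"
  have real: "Im (cinner (P z) z) = 0" for z
    using cinner_commute[of "P z" z] sym[of z z] by (simp add: complex_eq_iff)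
  have a: "cinner (P x) x = of_real a" and b: "cinner (P y) y = of_real b"
    by (simp_all add: a_def b_def complex_eq_iff real)
  have m': "cinner (P y) x = cnj m"
    unfolding m_def using sym[of y x] cinner_commute[of y "P x"] by simp
  have "(cmod m)\<^sup>2 \<le> a * (b + e)" if e: "e > 0" for e
  proof -
    have be: "b + e > 0" using nonneg[of y] e unfolding b_def by simp
    define t where "t = m / of_real (b + e)"
    have "0 \<le> Re (cinner (P (x - scaleC t y)) (x - scaleC t y))"
      by (rule nonneg)
    also have "cinner (P (x - scaleC t y)) (x - scaleC t y)
        = of_real a - cnj t * m - t * cnj m + t * cnj t * of_real b"
      by (simp add: clinear_op_diff[OF lin] clinear_op_scaleC[OF lin] cinner_diff_left
          cinner_diff_right cinner_scaleC_left cinner_scaleC_right a b m' algebra_simps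
          flip: m_def)
    also have "\<dots> = of_real (a - 2 * ((cmod m)\<^sup>2 / (b + e)) + (cmod m)\<^sup>2 / (b + e)\<^sup>2 * b)"
    proof -
      have 1: "m * cnj m = of_real ((cmod m)\<^sup>2)"
        by (simp add: complex_norm_square[symmetric])
      have 2: "cnj t * m = of_real ((cmod m)\<^sup>2 / (b + e))"
        "t * cnj m = of_real ((cmod m)\<^sup>2 / (b + e))"
        "t * cnj t = of_real ((cmod m)\<^sup>2 / (b + e)\<^sup>2)"
        using 1 by (simp_all add: t_def mult.commute power2_eq_square)
      show ?thesis unfolding 2 by simp
    qed
    finally have "0 \<le> a - 2 * ((cmod m)\<^sup>2 / (b + e)) + (cmod m)\<^sup>2 / (b + e)\<^sup>2 * b"
      by simp
    \<comment> \<open>Since \<open>b \<le> b + e\<close>, the last summand cancels at most one of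
      the two subtracted copies of \<open>(cmod m)\<^sup>2 / (b + e)\<close>.\<close>
    moreover have "(cmod m)\<^sup>2 / (b + e)\<^sup>2 * b \<le> (cmod m)\<^sup>2 / (b + e)"
    proof -
      have "b / (b + e) \<le> 1" using be e by simp
      then have "(cmod m)\<^sup>2 / (b + e) * (b / (b + e)) \<le> (cmod m)\<^sup>2 / (b + e)"
        using be by (intro mult_right_le_one_le) (use nonneg[of y] in \<open>auto simp: b_def\<close>)
      then show ?thesis by (simp add: power2_eq_square)
    qed
    ultimately have "(cmod m)\<^sup>2 / (b + e) \<le> a" by linarith
    then show ?thesis using be by (simp add: pos_divide_le_eq)
  qed
  then have "\<forall>\<^sub>F e in at_right 0. (cmod m)\<^sup>2 \<le> a * (b + e)"
    by (auto simp: eventually_at_right_less eventually_at intro: exI[of _ 1])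
  moreover have "((\<lambda>e. a * (b + e)) \<longlongrightarrow> a * (b + 0)) (at_right 0)"
    by (intro tendsto_intros)
  ultimately have "(cmod m)\<^sup>2 \<le> a * (b + 0)"
    by (intro tendsto_lowerbound) auto
  then show ?thesis by (simp add: m_def a_def b_def)
qed

text \<open>The semi-definite inequality for the identity operator.\<close>

lemma cinner_Cauchy_Schwarz: "cmod (cinner x y) \<le> norm x * norm (y :: 'a::complex_inner)"
proof -
  have "(cmod (cinner x y))\<^sup>2 \<le> (norm x * norm y)\<^sup>2"
    using semidefinite_Cauchy_Schwarz[OF clinear_op_id, of x y]
    by (simp add: cinner_self power_mult_distrib)
  then show ?thesis by (simp add: power2_le_iff_abs_le)
qed

text \<open>Conjugate linearity in the second argument is still linearity over the reals, which is
  enough to obtain joint continuity.\<close>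

lemma bounded_bilinear_cinner:
  "bounded_bilinear (cinner :: 'a::complex_inner \<Rightarrow> 'a \<Rightarrow> complex)"
proof
  show "\<exists>K. \<forall>(a::'a) b. norm (cinner a b) \<le> norm a * norm b * K"
    using cinner_Cauchy_Schwarz by (metis mult.right_neutral)
qed (auto simp: cinner_add_left cinner_add_right cinner_scaleR_left cinner_scaleR_right
    scaleR_conv_of_real)

lemmas tendsto_cinner = bounded_bilinear.tendsto[OF bounded_bilinear_cinner]

text \<open>The vector \<open>2\<langle>a, e\<rangle>e - a\<close> is the reflection of \<open>a\<close> in the line through \<open>e\<close>, so it has the
  norm of \<open>a\<close>.\<close>

lemma Buzano_inequality:
  fixes a b e :: "'a::complex_inner"
  assumes "norm e = 1"
  shows "cmod (cinner a e * cinner e b) \<le> (norm a * norm b + cmod (cinner a b)) / 2"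
proof -
  define t where "t = cinner a e"
  define r where "r = scaleC (2 * t) e - a"
  have "(norm r)\<^sup>2 = (2 * cmod t)\<^sup>2 - 2 * Re (2 * t * cinner e a) + (norm a)\<^sup>2"
    by (simp add: r_def norm_diff_sq norm_scaleC assms cinner_scaleC_left norm_mult)
  also have "cinner e a = cnj t"
    unfolding t_def by (rule cinner_commute)
  also have "2 * Re (2 * t * cnj t) = (2 * cmod t)\<^sup>2"
    by (simp add: mult.assoc complex_mult_cnj cmod_power2 power_mult_distrib)
  finally have norm_r: "norm r = norm a" by simp
  have "2 * (t * cinner e b) = cinner r b + cinner a b"
    by (simp add: r_def cinner_diff_left cinner_scaleC_left)
  then have "2 * cmod (t * cinner e b) = cmod (cinner r b + cinner a b)"
    by (metis norm_mult norm_numeral)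
  also have "\<dots> \<le> norm a * norm b + cmod (cinner a b)"
    using norm_triangle_ineq[of "cinner r b" "cinner a b"] cinner_Cauchy_Schwarz[of r b] norm_r
    by simp
  finally show ?thesis by (simp add: t_def)
qed

text \<open>The direct sum as an inner product space, so that Buzano's inequality applies to pairs.
  The product norm is already fixed and is shown to come from this inner product.\<close>

instantiation prod :: (complex_inner, complex_inner) complex_inner
begin

definition scaleC_prod :: "complex \<Rightarrow> 'a \<times> 'b \<Rightarrow> 'a \<times> 'b" where
  "scaleC_prod c x = (scaleC c (fst x), scaleC c (snd x))"

definition cinner_prod :: "'a \<times> 'b \<Rightarrow> 'a \<times> 'b \<Rightarrow> complex" where
  "cinner_prod x y = cinner (fst x) (fst y) + cinner (snd x) (snd y)"

instance
proof
  fix x y z :: "'a \<times> 'b" and a b r :: complex and s :: real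
  show "scaleC a (x + y) = scaleC a x + scaleC a y"
    "scaleC (a + b) x = scaleC a x + scaleC b x"
    "scaleC a (scaleC b x) = scaleC (a * b) x"
    "scaleC 1 x = x"
    "s *\<^sub>R x = scaleC (complex_of_real s) x"
    by (auto simp: scaleC_prod_def prod_eq_iff scaleC_add_right scaleC_add_left scaleC_scaleC
        scaleC_one scaleR_scaleC)
  show "cinner x y = cnj (cinner y x)"
    unfolding cinner_prod_def complex_cnj_add
    using cinner_commute[of "fst x" "fst y"] cinner_commute[of "snd x" "snd y"] by simp
  show "cinner (x + y) z = cinner x z + cinner y z" "cinner (scaleC r x) y = r * cinner x y"
    by (simp_all add: cinner_prod_def scaleC_prod_def cinner_add_left cinner_scaleC_left
        algebra_simps)
  show "Im (cinner x x) = 0" "0 \<le> Re (cinner x x)"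
    by (simp_all add: cinner_prod_def cinner_self_real cinner_self_nonneg)
  have self: "cinner x x = of_real ((norm (fst x))\<^sup>2 + (norm (snd x))\<^sup>2)"
    by (simp add: cinner_prod_def cinner_self)
  show "cinner x x = 0 \<longleftrightarrow> x = 0"
    unfolding self of_real_eq_0_iff by (simp add: sum_power2_eq_zero_iff prod_eq_iff)
  show "norm x = sqrt (Re (cinner x x))"
    unfolding self by (simp add: norm_prod_def)
qed

end

section \<open>Orthogonal decomposition and the adjoint\<close>

text \<open>A minimizing sequence is Cauchy: midpoints stay in \<open>M\<close>, hence at distance
  at least \<open>d\<close> from \<open>x\<close>, and the parallelogram law then forces two nearly
  optimal points to be close.\<close>

lemma minimal_distance_exists:
  fixes M :: "'a::chilbert_space set"
  assumes "closed M" and "M \<noteq> {}" and mid: "\<And>u v. u \<in> M \<Longrightarrow> v \<in> M \<Longrightarrow> (1/2) *\<^sub>R (u + v) \<in> M"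
  obtains m where "m \<in> M" and "\<And>u. u \<in> M \<Longrightarrow> norm (x - m) \<le> norm (x - u)"
proof -
  define d where "d = (INF u\<in>M. norm (x - u))"
  have bdd: "bdd_below ((\<lambda>u. norm (x - u)) ` M)" by (rule bdd_belowI[of _ 0]) auto
  have d_le: "d \<le> norm (x - u)" if "u \<in> M" for u
    unfolding d_def using that bdd by (rule cINF_lower[rotated])
  have d0: "0 \<le> d" unfolding d_def using assms(2) by (intro cINF_greatest) auto
  have "\<exists>u\<in>M. norm (x - u) < d + 1 / real (Suc n)" for n
    using cINF_less_iff[OF assms(2) bdd, of "d + 1 / real (Suc n)"] unfolding d_def by simp
  then obtain u where u: "\<And>n. u n \<in> M" and ud: "\<And>n. norm (x - u n) < d + 1 / real (Suc n)"
    by metis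
  have lim0: "(\<lambda>n. d + 1 / real (Suc n)) \<longlonglongrightarrow> d + 0"
    by (intro tendsto_intros LIMSEQ_Suc[OF lim_1_over_n])
  have limd: "(\<lambda>n. norm (x - u n)) \<longlonglongrightarrow> d"
  proof (rule tendsto_sandwich[of "\<lambda>_. d" _ _ "\<lambda>n. d + 1 / real (Suc n)"])
    show "(\<lambda>n. d + 1 / real (Suc n)) \<longlonglongrightarrow> d" using lim0 by simp
  qed (use d_le u less_imp_le[OF ud] in \<open>auto intro: always_eventually\<close>)
  \<comment> \<open>Parallelogram law for \<open>x - u m\<close> and \<open>x - u n\<close>, whose
    sum is twice the vector from the midpoint to \<open>x\<close>.\<close>
  have para: "(norm (u m - u n))\<^sup>2
      \<le> 2 * ((norm (x - u m))\<^sup>2 - d\<^sup>2) + 2 * ((norm (x - u n))\<^sup>2 - d\<^sup>2)" for m n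
  proof -
    have "(norm ((x - u m) + (x - u n)))\<^sup>2 + (norm ((x - u m) - (x - u n)))\<^sup>2
        = 2 * (norm (x - u m))\<^sup>2 + 2 * (norm (x - u n))\<^sup>2"
      unfolding norm_add_sq[of "x - u m"] norm_diff_sq[of "x - u m" "x - u n"] by simp
    moreover have "norm ((x - u m) + (x - u n)) = 2 * norm (x - (1/2) *\<^sub>R (u m + u n))"
    proof -
      have "(x - u m) + (x - u n) = 2 *\<^sub>R (x - (1/2) *\<^sub>R (u m + u n))"
        by (simp add: algebra_simps scaleR_2)
      then show ?thesis by (simp only: norm_scaleR)
    qed
    moreover have "d\<^sup>2 \<le> (norm (x - (1/2) *\<^sub>R (u m + u n)))\<^sup>2"
      using d_le[OF mid[OF u u]] d0 by (rule power_mono)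
    moreover have "norm ((x - u m) - (x - u n)) = norm (u m - u n)"
      by (simp add: norm_minus_commute)
    ultimately show ?thesis by (simp add: power_mult_distrib)
  qed
  have "Cauchy u"
  proof (rule metric_CauchyI)
    fix e :: real assume e: "e > 0"
    have "(\<lambda>n. (norm (x - u n))\<^sup>2 - d\<^sup>2) \<longlonglongrightarrow> d\<^sup>2 - d\<^sup>2"
      by (intro tendsto_intros limd)
    \<comment> \<open>In \<open>para\<close> each of the two excesses counts twice, so the threshold
      \<open>e\<^sup>2 / 4\<close> adds up to \<open>e\<^sup>2\<close>.\<close>
    then have "\<forall>\<^sub>F n in sequentially. (norm (x - u n))\<^sup>2 - d\<^sup>2 < e\<^sup>2 / 4"
      using e by (intro order_tendstoD) auto
    then obtain N where N: "\<And>n. n \<ge> N \<Longrightarrow> (norm (x - u n))\<^sup>2 - d\<^sup>2 < e\<^sup>2 / 4"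
      by (auto simp: eventually_sequentially)
    show "\<exists>N. \<forall>m\<ge>N. \<forall>n\<ge>N. dist (u m) (u n) < e"
    proof (intro exI allI impI)
      fix m n assume "m \<ge> N" "n \<ge> N"
      then have "(norm (u m - u n))\<^sup>2 < e\<^sup>2"
        using para[of m n] N[of m] N[of n] by (simp add: field_simps)
      then show "dist (u m) (u n) < e"
        unfolding dist_norm using e by (intro power_less_imp_less_base[of _ 2 e]) auto
    qed
  qed
  then obtain m where m: "u \<longlonglongrightarrow> m"
    using Cauchy_convergent convergent_def by blast
  have "m \<in> M" using \<open>closed M\<close> u m by (auto simp: closed_sequential_limits)
  moreover have "norm (x - m) = d"
    by (rule LIMSEQ_unique[OF tendsto_norm[OF tendsto_diff[OF tendsto_const m]] limd])
  ultimately show ?thesis using that d_le by auto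
qed

text \<open>Take \<open>m\<close> nearest to \<open>x\<close>: a nonzero inner product of
  \<open>x - m\<close> with some \<open>u\<close> in \<open>M\<close> would allow a shorter distance
  by moving \<open>m\<close> along \<open>u\<close>.\<close>

lemma orthogonal_decomposition:
  fixes M :: "'a::chilbert_space set"
  assumes "closed M" and "0 \<in> M" and add: "\<And>u v. u \<in> M \<Longrightarrow> v \<in> M \<Longrightarrow> u + v \<in> M"
    and scale: "\<And>c u. u \<in> M \<Longrightarrow> scaleC c u \<in> M"
  obtains m where "m \<in> M" and "\<And>u. u \<in> M \<Longrightarrow> cinner (x - m) u = 0"
proof -
  obtain m where m: "m \<in> M" and min: "\<And>u. u \<in> M \<Longrightarrow> norm (x - m) \<le> norm (x - u)"
  proof (rule minimal_distance_exists[of M x])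
    show "(1/2) *\<^sub>R (u + v) \<in> M" if "u \<in> M" "v \<in> M" for u v
      using add scale that by (simp add: scaleR_scaleC)
  qed (use assms in auto)
  have "cinner (x - m) u = 0" if u: "u \<in> M" for u
  proof (cases "u = 0")
    case False
    define k where "k = cinner (x - m) u"
    \<comment> \<open>The coefficient of the projection of \<open>x - m\<close> onto
      \<open>u\<close>. Minimality then reads \<open>2 * q \<le> q\<close> with
      \<open>q = (cmod k)\<^sup>2 / (norm u)\<^sup>2\<close>, so \<open>k = 0\<close>.\<close>
    define t where "t = k / of_real ((norm u)\<^sup>2)"
    have "norm (x - m) \<le> norm ((x - m) - scaleC t u)"
      using min[OF add[OF m scale[OF u, of t]]] by (simp add: algebra_simps)
    then have "(norm (x - m))\<^sup>2 \<le> (norm ((x - m) - scaleC t u))\<^sup>2"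
      by (intro power_mono) auto
    then have "2 * Re (cnj t * k) \<le> (cmod t * norm u)\<^sup>2"
      by (simp add: norm_diff_sq[of "x - m"] cinner_scaleC_right norm_scaleC k_def)
    moreover have "Re (cnj t * k) = (cmod k)\<^sup>2 / (norm u)\<^sup>2"
    proof -
      have "cnj t * k = (k * cnj k) / of_real ((norm u)\<^sup>2)"
        by (simp add: t_def mult.commute)
      also have "\<dots> = of_real ((cmod k)\<^sup>2 / (norm u)\<^sup>2)"
        by (simp add: complex_norm_square[symmetric])
      finally show ?thesis by simp
    qed
    moreover have "(cmod t * norm u)\<^sup>2 = (cmod k)\<^sup>2 / (norm u)\<^sup>2"
    proof -
      have "cmod t = cmod k / (norm u)\<^sup>2"
        by (simp add: t_def norm_divide norm_power)
      then show ?thesis using False by (simp add: power2_eq_square field_simps)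
    qed
    ultimately have "(cmod k)\<^sup>2 / (norm u)\<^sup>2 \<le> 0" by linarith
    then show ?thesis using False by (simp add: divide_le_0_iff k_def)
  qed simp
  then show ?thesis using that m by blast
qed

text \<open>The bound makes the kernel closed, so some \<open>v\<close> outside it is orthogonal to
  it. Subtracting a multiple of \<open>v\<close> moves any \<open>x\<close> into the kernel, so
  \<open>f\<close> is a multiple of the inner product with \<open>v\<close>.\<close>

lemma Riesz_representation:
  fixes f :: "'a::chilbert_space \<Rightarrow> complex"
  assumes add: "\<And>x y. f (x + y) = f x + f y" and scale: "\<And>c x. f (scaleC c x) = c * f x"
    and bound: "\<And>x. cmod (f x) \<le> norm x * K"
  obtains z where "\<And>x. f x = cinner x z"
proof (cases "\<forall>x. f x = 0")
  case True
  then show ?thesis using that[of 0] by simp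
next
  case False
  then obtain w where w: "f w \<noteq> 0" by auto
  have bl: "bounded_linear f"
    by (rule bounded_linear_intro[of _ K])
      (auto simp: add scaleR_scaleC scale bound scaleR_conv_of_real)
  have f0: "f 0 = 0" using add[of 0 0] by simp
  have diff: "f (x - y) = f x - f y" for x y
    using add[of "x - y" y] by simp
  have "closed {x. f x = 0}"
    by (intro closed_Collect_eq linear_continuous_on bl continuous_intros)
  then obtain m where m: "f m = 0" and orth: "\<And>u. f u = 0 \<Longrightarrow> cinner (w - m) u = 0"
    using orthogonal_decomposition[of "{x. f x = 0}" w] add scale f0 by auto
  define v where "v = w - m"
  have fv: "f v \<noteq> 0" using w m by (simp add: v_def diff)
  then have v0: "v \<noteq> 0" using f0 by auto
  \<comment> \<open>The scalar is fixed by the case \<open>x = v\<close>; it is conjugated because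
    the second argument is conjugate linear.\<close>
  have "f x = cinner x (scaleC (cnj (f v) / of_real ((norm v)\<^sup>2)) v)" for x
  proof -
    have "f (x - scaleC (f x / f v) v) = 0" using fv by (simp add: diff scale)
    then have "cinner (x - scaleC (f x / f v) v) v = 0"
      using orth cinner_commute[of _ v] unfolding v_def by (metis complex_cnj_zero)
    then have "cinner x v = f x / f v * of_real ((norm v)\<^sup>2)"
      by (simp add: cinner_diff_left cinner_scaleC_left cinner_self)
    then show ?thesis using v0 fv by (simp add: cinner_scaleC_right)
  qed
  then show ?thesis by (rule that)
qed

lemma eq_if_cinner_eq: "(\<And>x :: 'a::complex_inner. cinner x u = cinner x v) \<Longrightarrow> u = v"
  using cinner_self_eq_zero[of "u - v"] by (simp add: cinner_diff_right)

section \<open>Bounded operators and their adjoints\<close>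

lemma bounded_op_clinear: "bounded_op A \<Longrightarrow> clinear_op A"
  by (simp add: bounded_op_def)

lemma bounded_opI:
  assumes "\<And>x y. A (x + y) = A x + A y" and "\<And>c x. A (scaleC c x) = scaleC c (A x)"
    and "\<And>x. norm (A x) \<le> norm x * K"
  shows "bounded_op A"
  using assms unfolding bounded_op_def clinear_op_def by blast

text \<open>\<open>bounded_op\<close> prescribes no sign for its constant; a strictly positive one
  is later used as a divisor.\<close>

lemma bounded_op_pos_bound:
  assumes "bounded_op A"
  obtains K where "K > 0" and "\<And>x. norm (A x) \<le> K * norm x"
proof -
  obtain K where K: "\<And>x. norm (A x) \<le> norm x * K"
    using assms unfolding bounded_op_def by blast
  have "norm (A x) \<le> max K 1 * norm x" for x
    using K[of x] mult_left_mono[of K "max K 1" "norm x"] by (simp add: mult.commute)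
  then show ?thesis using that[of "max K 1"] by simp
qed

lemma bounded_op_bounded_linear: "bounded_op A \<Longrightarrow> bounded_linear A"
  unfolding bounded_op_def
  by (auto intro!: bounded_linear_intro simp: clinear_op_add clinear_op_scaleR)

lemma bounded_op_comp:
  assumes "bounded_op A" "bounded_op B"
  shows "bounded_op (A \<circ> B)"
proof -
  obtain K L where K: "K > 0" "\<And>x. norm (A x) \<le> K * norm x" and L: "\<And>x. norm (B x) \<le> L * norm x"
    using assms bounded_op_pos_bound by metis
  have "norm ((A \<circ> B) x) \<le> norm x * (K * L)" for x
    using order_trans[OF K(2)[of "B x"] mult_left_mono[OF L[of x], of K]] K(1)
    by (simp add: mult_ac)
  then show ?thesis
    by (rule bounded_opI[rotated 2])
      (simp_all add: assms bounded_op_clinear clinear_op_add clinear_op_scaleC)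
qed

text \<open>Riesz representation of the functional \<open>\<lambda>x. cinner (A x) y\<close> for
  each \<open>y\<close>.\<close>

lemma adj_exists:
  fixes A :: "'a::chilbert_space \<Rightarrow> 'a"
  assumes "bounded_op A"
  obtains A' where "bounded_op A'" and "\<And>x y. cinner (A x) y = cinner x (A' y)"
proof -
  note lin = bounded_op_clinear[OF assms]
  obtain K where K: "K > 0" "\<And>x. norm (A x) \<le> K * norm x"
    using assms bounded_op_pos_bound by blast
  have "\<exists>z. \<forall>x. cinner (A x) y = cinner x z" for y
  proof -
    have "cmod (cinner (A x) y) \<le> norm x * (K * norm y)" for x
      using cinner_Cauchy_Schwarz[of "A x" y] mult_right_mono[OF K(2)[of x], of "norm y"]
      by (simp add: mult_ac)
    then show ?thesis
      using Riesz_representation[of "\<lambda>x. cinner (A x) y" "K * norm y"]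
      by (metis lin clinear_op_add clinear_op_scaleC cinner_add_left cinner_scaleC_left)
  qed
  then obtain A' where A': "\<And>x y. cinner (A x) y = cinner x (A' y)" by metis
  have "bounded_op A'"
  proof (rule bounded_opI)
    show "A' (x + y) = A' x + A' y" for x y
      by (rule eq_if_cinner_eq) (simp add: cinner_add_right flip: A')
    show "A' (scaleC c x) = scaleC c (A' x)" for c x
      by (rule eq_if_cinner_eq) (simp add: cinner_scaleC_right flip: A')
    show "norm (A' x) \<le> norm x * K" for x
    proof (cases "A' x = 0")
      case False
      \<comment> \<open>Testing the adjoint relation at \<open>A' x\<close> gives a bound with an
        extra factor \<open>norm (A' x)\<close>, which is then cancelled.\<close>
      have "(norm (A' x))\<^sup>2 = cmod (cinner (A (A' x)) x)"
        by (simp add: A' cinner_self norm_power)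
      also have "\<dots> \<le> K * norm (A' x) * norm x"
        using cinner_Cauchy_Schwarz[of "A (A' x)" x] mult_right_mono[OF K(2)[of "A' x"], of "norm x"]
        by simp
      finally have "norm (A' x) * norm (A' x) \<le> norm (A' x) * (norm x * K)"
        by (simp add: power2_eq_square mult_ac)
      then show ?thesis using False by simp
    qed (use K in simp)
  qed
  then show ?thesis using that A' by blast
qed

text \<open>The adjoint relation determines \<open>A'\<close> pointwise, so the definite description
  in \<open>adj\<close> is met by any operator satisfying it.\<close>

lemma adj_eqI:
  assumes "bounded_op A'" and "\<And>x y. cinner (A x) y = cinner x (A' y)"
  shows "adj A = A'"
  unfolding adj_def
proof (rule the_equality)
  show "F = A'" if "bounded_op F \<and> (\<forall>x y. cinner (A x) y = cinner x (F y))" for F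
    by (intro ext eq_if_cinner_eq) (use that assms(2) in metis)
qed (use assms in blast)

lemma
  assumes "bounded_op A"
  shows bounded_op_adj: "bounded_op (adj A)"
    and cinner_adj_right: "cinner (A x) y = cinner x (adj A y)"
proof -
  obtain A' where A': "bounded_op A'" "\<And>x y. cinner (A x) y = cinner x (A' y)"
    using adj_exists[OF assms] by blast
  then have "adj A = A'" by (rule adj_eqI)
  with A' show "bounded_op (adj A)" "cinner (A x) y = cinner x (adj A y)" by simp_all
qed

lemma cinner_adj_left:
  assumes "bounded_op A"
  shows "cinner (adj A x) y = cinner x (A y)"
  using cinner_adj_right[OF assms, of y x] cinner_commute[of "adj A x" y]
    cinner_commute[of x "A y"] by simp

lemma adj_adj: "bounded_op A \<Longrightarrow> adj (adj A) = A"
  by (rule adj_eqI) (simp_all add: cinner_adj_left)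

section \<open>Positive square roots\<close>

text \<open>Makes the comparison test for series available, by which the iteration below
  converges.\<close>

instance chilbert_space \<subseteq> banach ..

text \<open>The iterates of \<open>X = (A + X\<^sup>2) / 2\<close> with \<open>A = 1 - P\<close>: at the limit \<open>(1 - X)\<^sup>2 = P\<close>.\<close>

primrec sqrt_iter :: "('a::real_vector \<Rightarrow> 'a) \<Rightarrow> nat \<Rightarrow> 'a \<Rightarrow> 'a" where
  "sqrt_iter A 0 = (\<lambda>x. 0)"
| "sqrt_iter A (Suc n) = (\<lambda>x. (1/2) *\<^sub>R (A x + sqrt_iter A n (sqrt_iter A n x)))"

text \<open>The same iteration for the scalar \<open>A = 1\<close>; it majorizes the operator iteration.\<close>

primrec sqrt_iter_bound :: "nat \<Rightarrow> real" where
  "sqrt_iter_bound 0 = 0"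
| "sqrt_iter_bound (Suc n) = (1 + (sqrt_iter_bound n)\<^sup>2) / 2"

lemma sqrt_iter_bound_nonneg: "0 \<le> sqrt_iter_bound n"
  by (cases n) auto

lemma sqrt_iter_bound_le_1: "sqrt_iter_bound n \<le> 1"
proof (induction n)
  case (Suc n)
  then show ?case using power_le_one[OF sqrt_iter_bound_nonneg, of n 2] by simp
qed simp

text \<open>Each increment is half the square of \<open>sqrt_iter_bound n - 1\<close>.\<close>

lemma sqrt_iter_bound_incseq: "incseq sqrt_iter_bound"
proof (rule incseq_SucI)
  show "sqrt_iter_bound n \<le> sqrt_iter_bound (Suc n)" for n
    using zero_le_power2[of "sqrt_iter_bound n - 1"] by (simp add: power2_eq_square algebra_simps)
qed

lemma sqrt_iter_bound_convergent: "convergent sqrt_iter_bound"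
  using incseq_convergent[OF sqrt_iter_bound_incseq] sqrt_iter_bound_le_1
  by (metis convergent_def)

text \<open>Every iterate is a polynomial in the operator, the same one for \<open>A\<close> and
  \<open>A'\<close>.\<close>

lemma sqrt_iter_intertwine:
  assumes T: "clinear_op T" and TA: "\<And>x. T (A x) = A' (T x)"
  shows "T (sqrt_iter A n x) = sqrt_iter A' n (T x)"
proof (induction n arbitrary: x)
  case 0
  then show ?case using clinear_op_scaleR[OF T, of 0 0] by simp
next
  case (Suc n)
  then show ?case by (simp add: clinear_op_scaleR[OF T] clinear_op_add[OF T] TA)
qed

text \<open>\<open>A\<close> will be \<open>1 - P / c\<close> for a positive \<open>P\<close>
  bounded by \<open>c\<close>.\<close>

locale symmetric_contraction =
  fixes A :: "'a::chilbert_space \<Rightarrow> 'a"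
  assumes linear: "clinear_op A"
    and sym: "cinner (A x) y = cinner x (A y)"
    and contraction: "norm (A x) \<le> norm x"
begin

lemma linear_iter: "clinear_op (sqrt_iter A n)"
proof (induction n)
  case 0
  then show ?case
    using scaleC_diff_right[of _ 0 "0 :: 'a"] by (simp add: clinear_op_def)
next
  case (Suc n)
  then show ?case
    unfolding clinear_op_def
    by (simp add: clinear_op_add[OF linear] clinear_op_scaleC[OF linear] scaleR_scaleC
        scaleC_add_right scaleC_scaleC mult.commute)
qed

lemma sym_iter: "cinner (sqrt_iter A n x) y = cinner x (sqrt_iter A n y)"
proof (induction n arbitrary: x y)
  case (Suc n)
  then show ?case
    by (simp add: cinner_scaleR_left cinner_scaleR_right cinner_add_left cinner_add_right sym)
qed simp

lemma norm_iter: "norm (sqrt_iter A n x) \<le> sqrt_iter_bound n * norm x"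
proof (induction n arbitrary: x)
  case (Suc n)
  have "norm (sqrt_iter A n (sqrt_iter A n x)) \<le> sqrt_iter_bound n * norm (sqrt_iter A n x)"
    by (rule Suc)
  also have "\<dots> \<le> sqrt_iter_bound n * (sqrt_iter_bound n * norm x)"
    by (intro mult_left_mono Suc sqrt_iter_bound_nonneg)
  finally have "norm (A x + sqrt_iter A n (sqrt_iter A n x))
      \<le> norm x + sqrt_iter_bound n * (sqrt_iter_bound n * norm x)"
    using norm_triangle_ineq[of "A x" "sqrt_iter A n (sqrt_iter A n x)"] contraction[of x]
    by linarith
  then show ?case by (simp add: power2_eq_square distrib_right)
qed simp

lemma norm_iter_le: "norm (sqrt_iter A n x) \<le> norm x"
  using norm_iter[of n x] mult_right_mono[OF sqrt_iter_bound_le_1[of n] norm_ge_zero[of x]]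
  by simp

text \<open>Intertwining is applied twice: \<open>A\<close> commutes with the \<open>m\<close>-th
  iterate, hence the \<open>m\<close>-th iterate commutes with the \<open>n\<close>-th.\<close>

lemma iter_commute: "sqrt_iter A m (sqrt_iter A n x) = sqrt_iter A n (sqrt_iter A m x)"
  by (rule sqrt_iter_intertwine[OF linear_iter])
    (rule sqrt_iter_intertwine[of A A A, OF linear refl, symmetric])

text \<open>For commuting \<open>X\<close> and \<open>Y\<close> the difference of squares factors as
  \<open>(Y + X) (Y - X)\<close>. The scalar increments obey the same recursion with equality, so
  they dominate the operator increments.\<close>

lemma norm_iter_step:
  "norm (sqrt_iter A (Suc n) x - sqrt_iter A n x)
    \<le> (sqrt_iter_bound (Suc n) - sqrt_iter_bound n) * norm x"
proof (induction n)
  case 0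
  then show ?case using contraction[of x] by simp
next
  case (Suc n)
  define X where "X = sqrt_iter A n"
  define Y where "Y = sqrt_iter A (Suc n)"
  define p where "p = sqrt_iter_bound n"
  define q where "q = sqrt_iter_bound (Suc n)"
  have diff: "X (u - v) = X u - X v" "Y (u - v) = Y u - Y v" for u v
    unfolding X_def Y_def by (intro clinear_op_diff linear_iter)+
  have comm: "Y (X x) = X (Y x)"
    unfolding X_def Y_def by (rule iter_commute)
  have "sqrt_iter A (Suc (Suc n)) x - sqrt_iter A (Suc n) x = (1/2) *\<^sub>R (Y (Y x) - X (X x))"
    unfolding sqrt_iter.simps(2)[of A "Suc n"] Y_def[symmetric]
    by (subst (2) Y_def) (simp add: X_def algebra_simps)
  also have "Y (Y x) - X (X x) = Y (Y x - X x) + X (Y x - X x)"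
    by (simp add: diff comm)
  finally have "norm (sqrt_iter A (Suc (Suc n)) x - sqrt_iter A (Suc n) x)
      = (1/2) * norm (Y (Y x - X x) + X (Y x - X x))"
    by simp
  also have "\<dots> \<le> (1/2) * (q * norm (Y x - X x) + p * norm (Y x - X x))"
    using norm_triangle_ineq[of "Y (Y x - X x)" "X (Y x - X x)"]
      norm_iter[of n "Y x - X x"] norm_iter[of "Suc n" "Y x - X x"]
    unfolding X_def[symmetric] Y_def[symmetric] p_def[symmetric] q_def[symmetric]
    by (intro mult_left_mono) simp_all
  also have "\<dots> = (1/2) * (q + p) * norm (Y x - X x)"
    by (simp add: algebra_simps)
  also have "\<dots> \<le> (1/2) * (q + p) * ((q - p) * norm x)"
    using Suc sqrt_iter_bound_nonneg[of n] sqrt_iter_bound_nonneg[of "Suc n"]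
    unfolding X_def Y_def p_def q_def by (intro mult_left_mono mult_nonneg_nonneg) linarith+
  also have "\<dots> = (sqrt_iter_bound (Suc (Suc n)) - sqrt_iter_bound (Suc n)) * norm x"
    unfolding sqrt_iter_bound.simps(2)[of "Suc n"] q_def[symmetric]
    by (subst (4) q_def) (simp add: p_def power2_eq_square field_simps)
  finally show ?case .
qed

definition limit :: "'a \<Rightarrow> 'a" where
  "limit x = lim (\<lambda>n. sqrt_iter A n x)"

text \<open>The increments are dominated by those of the convergent scalar sequence, which telescope
  to a summable series.\<close>

lemma tendsto_limit: "(\<lambda>n. sqrt_iter A n x) \<longlonglongrightarrow> limit x"
proof -
  obtain l where "sqrt_iter_bound \<longlonglongrightarrow> l"
    using sqrt_iter_bound_convergent convergent_def by blast
  then have "summable (\<lambda>n. (sqrt_iter_bound (Suc n) - sqrt_iter_bound n) * norm x)"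
    by (intro summable_mult2 telescope_summable)
  then have "summable (\<lambda>n. sqrt_iter A (Suc n) x - sqrt_iter A n x)"
    by (rule summable_comparison_test'[of _ 0]) (rule norm_iter_step)
  then have "convergent (\<lambda>n. \<Sum>k<n. sqrt_iter A (Suc k) x - sqrt_iter A k x)"
    by (simp add: summable_iff_convergent)
  then have "convergent (\<lambda>n. sqrt_iter A n x)"
    unfolding sum_lessThan_telescope[of "\<lambda>n. sqrt_iter A n x"] by simp
  then show ?thesis
    unfolding limit_def by (rule convergent_LIMSEQ_iff[THEN iffD1])
qed

lemma norm_limit: "norm (limit x) \<le> norm x"
  by (rule tendsto_upperbound[OF tendsto_norm[OF tendsto_limit]])
    (auto intro: norm_iter_le always_eventually)

lemma sym_limit: "cinner (limit x) y = cinner x (limit y)"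
proof (rule LIMSEQ_unique)
  show "(\<lambda>n. cinner (sqrt_iter A n x) y) \<longlonglongrightarrow> cinner (limit x) y"
    by (intro tendsto_cinner tendsto_limit tendsto_const)
  show "(\<lambda>n. cinner (sqrt_iter A n x) y) \<longlonglongrightarrow> cinner x (limit y)"
    unfolding sym_iter by (intro tendsto_cinner tendsto_limit tendsto_const)
qed

text \<open>Symmetry moves \<open>limit\<close> to the other argument, where the claim becomes one
  about the inner product alone.\<close>

lemma linear_limit: "clinear_op limit"
  unfolding clinear_op_def
proof (intro conjI allI)
  show "limit (x + y) = limit x + limit y" for x y
    by (rule eq_if_cinner_eq) (simp add: cinner_add_right flip: sym_limit)
  show "limit (scaleC c x) = scaleC c (limit x)" for c x
    by (rule eq_if_cinner_eq) (simp add: cinner_scaleC_right flip: sym_limit)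
qed

lemma limit_fixpoint: "2 *\<^sub>R limit x = A x + limit (limit x)"
proof -
  \<comment> \<open>Convergence is only pointwise, so for the composition the inner argument is
    first replaced by its limit; all iterates being contractions, the error vanishes.\<close>
  have "(\<lambda>n. sqrt_iter A n (sqrt_iter A n x) - sqrt_iter A n (limit x)) \<longlonglongrightarrow> 0"
  proof (rule Lim_null_comparison)
    show "\<forall>\<^sub>F n in sequentially. norm (sqrt_iter A n (sqrt_iter A n x) - sqrt_iter A n (limit x))
        \<le> norm (sqrt_iter A n x - limit x)"
      using norm_iter_le by (simp add: clinear_op_diff[OF linear_iter, symmetric])
    show "(\<lambda>n. norm (sqrt_iter A n x - limit x)) \<longlonglongrightarrow> 0"
      using tendsto_limit by (simp add: LIM_zero tendsto_norm_zero)
  qed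
  from tendsto_add[OF this tendsto_limit[of "limit x"]]
  have "(\<lambda>n. sqrt_iter A n (sqrt_iter A n x)) \<longlonglongrightarrow> limit (limit x)"
    by simp
  then have "(\<lambda>n. (1/2) *\<^sub>R (A x + sqrt_iter A n (sqrt_iter A n x)))
      \<longlonglongrightarrow> (1/2) *\<^sub>R (A x + limit (limit x))"
    by (intro tendsto_intros)
  moreover have "(\<lambda>n. (1/2) *\<^sub>R (A x + sqrt_iter A n (sqrt_iter A n x))) \<longlonglongrightarrow> limit x"
    using LIMSEQ_Suc[OF tendsto_limit[of x]] by simp
  ultimately have "limit x = (1/2) *\<^sub>R (A x + limit (limit x))"
    by (rule LIMSEQ_unique[symmetric])
  then have "2 *\<^sub>R limit x = 2 *\<^sub>R ((1/2) *\<^sub>R (A x + limit (limit x)))"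
    by (rule arg_cong)
  then show ?thesis by simp
qed

end

lemma limit_intertwine:
  assumes "symmetric_contraction A" "symmetric_contraction A'"
    and T: "bounded_op T" and TA: "\<And>x. T (A x) = A' (T x)"
  shows "T (symmetric_contraction.limit A x) = symmetric_contraction.limit A' (T x)"
proof (rule LIMSEQ_unique)
  show "(\<lambda>n. T (sqrt_iter A n x)) \<longlonglongrightarrow> T (symmetric_contraction.limit A x)"
    by (intro bounded_linear.tendsto[OF bounded_op_bounded_linear[OF T]]
        symmetric_contraction.tendsto_limit assms)
  show "(\<lambda>n. T (sqrt_iter A n x)) \<longlonglongrightarrow> symmetric_contraction.limit A' (T x)"
    unfolding sqrt_iter_intertwine[of T A A', OF bounded_op_clinear[OF T] TA]
    by (intro symmetric_contraction.tendsto_limit assms)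
qed

section \<open>Positive operators and their square roots\<close>

lemma positive_op_bounded: "positive_op P \<Longrightarrow> bounded_op P"
  by (simp add: positive_op_def)

lemma positive_op_clinear: "positive_op P \<Longrightarrow> clinear_op P"
  by (simp add: positive_op_bounded bounded_op_clinear)

lemma positive_op_nonneg: "positive_op P \<Longrightarrow> 0 \<le> Re (cinner (P x) x)"
  by (simp add: positive_op_def)

text \<open>Polarization: reality of the form at \<open>x + y\<close> makes the imaginary parts
  opposite, and at \<open>x + scaleC \<i> y\<close> it makes the real parts equal.\<close>

lemma positive_op_sym:
  assumes P: "positive_op P"
  shows "cinner (P x) y = cinner x (P y)"
proof -
  note lin = positive_op_clinear[OF P]
  have real: "Im (cinner (P z) z) = 0" for z
    using P by (simp add: positive_op_def)
  have "Im (cinner (P x) y) + Im (cinner (P y) x) = 0"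
    using real[of "x + y"] real[of x] real[of y]
    by (simp add: clinear_op_add[OF lin] cinner_add_left cinner_add_right)
  moreover have "Re (cinner (P y) x) = Re (cinner (P x) y)"
    using real[of "x + scaleC \<i> y"] real[of x] real[of y]
    by (simp add: clinear_op_add[OF lin] clinear_op_scaleC[OF lin] cinner_add_left
        cinner_add_right cinner_scaleC_left cinner_scaleC_right)
  ultimately have "cnj (cinner (P y) x) = cinner (P x) y"
    by (simp add: complex_eq_iff)
  then show ?thesis using cinner_commute[of x "P y"] by simp
qed

lemma positive_op_Cauchy_Schwarz:
  assumes "positive_op P"
  shows "(cmod (cinner (P x) y))\<^sup>2 \<le> Re (cinner (P x) x) * Re (cinner (P y) y)"
  using assms
  by (intro semidefinite_Cauchy_Schwarz positive_op_clinear positive_op_sym positive_op_nonneg)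

text \<open>Cauchy-Schwarz for the form of \<open>P\<close>, tested against
  \<open>P x\<close>.\<close>

lemma positive_op_eq_zero:
  assumes "positive_op P" "Re (cinner (P x) x) = 0"
  shows "P x = 0"
  using positive_op_Cauchy_Schwarz[OF assms(1), of x "P x"] assms(2) by (simp add: cinner_self)

text \<open>The operator inequality \<open>P\<^sup>2 \<le> c P\<close>. Cauchy-Schwarz against
  \<open>P x\<close> bounds the fourth power of \<open>norm (P x)\<close>, and two of its factors
  cancel.\<close>

lemma positive_op_norm_sq_le:
  assumes P: "positive_op P" and c: "c > 0" and bound: "\<And>x. norm (P x) \<le> c * norm x"
  shows "(norm (P x))\<^sup>2 \<le> c * Re (cinner (P x) x)"
proof (cases "P x = 0")
  case False
  have "Re (cinner (P (P x)) (P x)) \<le> norm (P (P x)) * norm (P x)"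
    using complex_Re_le_cmod cinner_Cauchy_Schwarz order_trans by blast
  also have "\<dots> \<le> c * norm (P x) * norm (P x)"
    by (intro mult_right_mono bound) simp
  finally have "Re (cinner (P (P x)) (P x)) \<le> c * (norm (P x))\<^sup>2"
    by (simp add: power2_eq_square mult.assoc)
  then have "Re (cinner (P x) x) * Re (cinner (P (P x)) (P x))
      \<le> Re (cinner (P x) x) * (c * (norm (P x))\<^sup>2)"
    by (intro mult_left_mono positive_op_nonneg P)
  moreover have "((norm (P x))\<^sup>2)\<^sup>2 \<le> Re (cinner (P x) x) * Re (cinner (P (P x)) (P x))"
    using positive_op_Cauchy_Schwarz[OF P, of x "P x"] by (simp add: cinner_self norm_power)
  ultimately have "(norm (P x))\<^sup>2 * (norm (P x))\<^sup>2 \<le> (c * Re (cinner (P x) x)) * (norm (P x))\<^sup>2"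
    by (simp add: power2_eq_square mult_ac)
  then show ?thesis using False by (simp only: mult_le_cancel_right) simp
qed (use c in simp)

text \<open>With \<open>X\<close> the limit for \<open>1 - P / c\<close>, this is
  \<open>sqrt c\<close> times \<open>1 - X\<close>. Keeping \<open>c\<close> as a parameter lets two
  operators share one scale.\<close>

definition scaled_sqrt :: "real \<Rightarrow> ('a::chilbert_space \<Rightarrow> 'a) \<Rightarrow> 'a \<Rightarrow> 'a" where
  "scaled_sqrt c P x
    = sqrt c *\<^sub>R (x - symmetric_contraction.limit (\<lambda>x. x - (1 / c) *\<^sub>R P x) x)"

text \<open>In the expanded square the quadratic term
  \<open>(norm (P x))\<^sup>2 / c\<^sup>2\<close> is absorbed by half of the linear term, by
  \<open>positive_op_norm_sq_le\<close>.\<close>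

lemma symmetric_contraction_scaled:
  assumes P: "positive_op P" and c: "c > 0" and bound: "\<And>x. norm (P x) \<le> c * norm x"
  shows "symmetric_contraction (\<lambda>x. x - (1 / c) *\<^sub>R P x)"
proof
  note lin = positive_op_clinear[OF P]
  show "clinear_op (\<lambda>x. x - (1 / c) *\<^sub>R P x)"
    by (simp add: clinear_op_def clinear_op_add[OF lin] clinear_op_scaleC[OF lin] scaleR_scaleC
        scaleC_diff_right scaleC_add_right scaleC_scaleC mult.commute)
  show "cinner (x - (1 / c) *\<^sub>R P x) y = cinner x (y - (1 / c) *\<^sub>R P y)" for x y
    by (simp add: cinner_diff_left cinner_diff_right cinner_scaleR_left cinner_scaleR_right
        positive_op_sym[OF P])
  show "norm (x - (1 / c) *\<^sub>R P x) \<le> norm x" for x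
  proof -
    have "(norm (x - (1 / c) *\<^sub>R P x))\<^sup>2
        = (norm x)\<^sup>2 - 2 * (Re (cinner (P x) x) / c) + (norm (P x))\<^sup>2 / c\<^sup>2"
      by (simp add: norm_diff_sq cinner_scaleR_right positive_op_sym[OF P] power_divide)
    also have "(norm (P x))\<^sup>2 / c\<^sup>2 \<le> Re (cinner (P x) x) / c"
      using positive_op_norm_sq_le[OF assms, of x] c
      by (simp add: power2_eq_square field_simps)
    finally have "(norm (x - (1 / c) *\<^sub>R P x))\<^sup>2 \<le> (norm x)\<^sup>2"
      using divide_nonneg_pos[OF positive_op_nonneg[OF P, of x] c] by linarith
    then show ?thesis by (simp add: power2_le_iff_abs_le)
  qed
qed

text \<open>Positivity holds because \<open>limit\<close> is a symmetric contraction, and the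
  fixpoint equation turns \<open>(1 - X)\<^sup>2\<close> into \<open>P / c\<close>.\<close>

lemma
  assumes P: "positive_op P" and c: "c > 0" and bound: "\<And>x. norm (P x) \<le> c * norm x"
  shows positive_op_scaled_sqrt: "positive_op (scaled_sqrt c P)"
    and scaled_sqrt_sq: "scaled_sqrt c P (scaled_sqrt c P x) = P x"
proof -
  interpret symmetric_contraction "\<lambda>x. x - (1 / c) *\<^sub>R P x"
    using assms by (rule symmetric_contraction_scaled)
  have S: "scaled_sqrt c P x = sqrt c *\<^sub>R (x - limit x)" for x
    by (simp add: scaled_sqrt_def)
  have "bounded_op (scaled_sqrt c P)"
  proof (rule bounded_opI)
    show "scaled_sqrt c P (x + y) = scaled_sqrt c P x + scaled_sqrt c P y" for x y
      by (simp add: S clinear_op_add[OF linear_limit] algebra_simps)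
    show "scaled_sqrt c P (scaleC k x) = scaleC k (scaled_sqrt c P x)" for k x
      unfolding S clinear_op_scaleC[OF linear_limit] scaleR_scaleC[of "sqrt c"]
      by (simp add: scaleC_diff_right scaleC_scaleC mult.commute)
    show "norm (scaled_sqrt c P x) \<le> norm x * (2 * sqrt c)" for x
      using norm_triangle_ineq4[of x "limit x"] norm_limit[of x] c
      by (simp add: S mult.commute[of "norm x"] mult.assoc)
  qed
  moreover have "Im (cinner (scaled_sqrt c P x) x) = 0" for x
  proof -
    have "Im (cinner (limit x) x) = 0"
      using sym_limit[of x x] cinner_commute[of x "limit x"] by (simp add: complex_eq_iff)
    then show ?thesis by (simp add: S cinner_scaleR_left cinner_diff_left cinner_self_real)
  qed
  moreover have "0 \<le> Re (cinner (scaled_sqrt c P x) x)" for x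
  proof -
    have "Re (cinner (limit x) x) \<le> norm (limit x) * norm x"
      using complex_Re_le_cmod cinner_Cauchy_Schwarz order_trans by blast
    also have "\<dots> \<le> norm x * norm x"
      by (intro mult_right_mono norm_limit) simp
    finally show ?thesis
      using c by (simp add: S cinner_scaleR_left cinner_diff_left cinner_self power2_eq_square)
  qed
  ultimately show "positive_op (scaled_sqrt c P)" by (simp add: positive_op_def)
  have "scaled_sqrt c P (scaled_sqrt c P x)
      = (sqrt c * sqrt c) *\<^sub>R (x - 2 *\<^sub>R limit x + limit (limit x))"
    by (simp only: S clinear_op_scaleR[OF linear_limit] clinear_op_diff[OF linear_limit])
      (simp add: algebra_simps scaleR_2)
  also have "\<dots> = P x"
    using c by (simp add: limit_fixpoint algebra_simps)
  finally show "scaled_sqrt c P (scaled_sqrt c P x) = P x" .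
qed

text \<open>With a common \<open>c\<close>, both roots are limits of the same polynomials in
  \<open>P\<close> and \<open>Q\<close>.\<close>

lemma scaled_sqrt_intertwine:
  assumes "positive_op P" "positive_op Q" "c > 0"
    and "\<And>x. norm (P x) \<le> c * norm x" "\<And>x. norm (Q x) \<le> c * norm x"
    and T: "bounded_op T" and TP: "\<And>x. T (P x) = Q (T x)"
  shows "T (scaled_sqrt c P x) = scaled_sqrt c Q (T x)"
proof -
  note lin = bounded_op_clinear[OF T]
  have "T (symmetric_contraction.limit (\<lambda>x. x - (1 / c) *\<^sub>R P x) x)
      = symmetric_contraction.limit (\<lambda>x. x - (1 / c) *\<^sub>R Q x) (T x)"
  proof (rule limit_intertwine)
    show "T (x - (1 / c) *\<^sub>R P x) = T x - (1 / c) *\<^sub>R Q (T x)" for x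
      by (simp add: clinear_op_diff[OF lin] clinear_op_scaleR[OF lin] TP)
  qed (intro symmetric_contraction_scaled assms)+
  then show ?thesis
    by (simp add: scaled_sqrt_def clinear_op_diff[OF lin] clinear_op_scaleR[OF lin])
qed

text \<open>If \<open>w = (S - R)x\<close>, then \<open>\<langle>Sw, w\<rangle> + \<langle>Rw, w\<rangle> = \<langle>(S\<^sup>2 - R\<^sup>2)x, w\<rangle> = 0\<close>, so both terms vanish.\<close>

lemma commuting_positive_sqrt_unique:
  assumes S: "positive_op S" and R: "positive_op R" and comm: "\<And>x. R (S x) = S (R x)"
    and sq: "\<And>x. S (S x) = R (R x)"
  shows "S = R"
proof
  fix x
  note diff = clinear_op_diff[OF positive_op_clinear[OF S]]
    clinear_op_diff[OF positive_op_clinear[OF R]]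
  define w where "w = S x - R x"
  have "S w + R w = 0"
    by (simp add: w_def diff comm sq)
  then have "cinner (S w) w + cinner (R w) w = 0"
    by (simp flip: cinner_add_left)
  then have "Re (cinner (S w) w) + Re (cinner (R w) w) = 0"
    by (simp flip: plus_complex.sel)
  then have "Re (cinner (S w) w) = 0" "Re (cinner (R w) w) = 0"
    using positive_op_nonneg[OF S, of w] positive_op_nonneg[OF R, of w] by linarith+
  then have "S w = 0" "R w = 0"
    using positive_op_eq_zero S R by blast+
  then have "cinner (S x - R x) w = 0"
    by (simp add: cinner_diff_left positive_op_sym[OF S] positive_op_sym[OF R])
  then show "S x = R x"
    using cinner_self_eq_zero[of w] by (simp add: w_def)
qed

text \<open>Any positive root \<open>R\<close> commutes with \<open>P\<close>, its own square, hence
  with \<open>scaled_sqrt c P\<close>; uniqueness among commuting roots then applies.\<close>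

lemma op_sqrt_eq_scaled_sqrt:
  assumes P: "positive_op P" and c: "c > 0" and bound: "\<And>x. norm (P x) \<le> c * norm x"
  shows "op_sqrt P = scaled_sqrt c P"
  unfolding op_sqrt_def
proof (rule the_equality)
  note S = positive_op_scaled_sqrt[OF assms] and sq = scaled_sqrt_sq[OF assms]
  show "positive_op (scaled_sqrt c P) \<and> scaled_sqrt c P \<circ> scaled_sqrt c P = P"
    using S sq by (simp add: fun_eq_iff)
  fix R assume R: "positive_op R \<and> R \<circ> R = P"
  then have RR: "R (R x) = P x" for x by (auto simp: fun_eq_iff)
  have "scaled_sqrt c P = R"
  proof (rule commuting_positive_sqrt_unique)
    show "R (scaled_sqrt c P x) = scaled_sqrt c P (R x)" for x
    proof (rule scaled_sqrt_intertwine)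
      show "R (P x) = P (R x)" for x unfolding RR[symmetric] ..
    qed (use assms R positive_op_bounded in blast)+
  qed (use S R sq RR in auto)
  then show "R = scaled_sqrt c P" by simp
qed

lemma
  assumes P: "positive_op P"
  shows positive_op_op_sqrt: "positive_op (op_sqrt P)"
    and op_sqrt_sq: "op_sqrt P (op_sqrt P x) = P x"
proof -
  obtain c where c: "c > 0" "\<And>x. norm (P x) \<le> c * norm x"
    using bounded_op_pos_bound[OF positive_op_bounded[OF P]] by blast
  show "positive_op (op_sqrt P)" "op_sqrt P (op_sqrt P x) = P x"
    unfolding op_sqrt_eq_scaled_sqrt[OF P c]
    using positive_op_scaled_sqrt[OF P c] scaled_sqrt_sq[OF P c] by auto
qed

lemma op_sqrt_intertwine:
  assumes P: "positive_op P" and Q: "positive_op Q" and T: "bounded_op T"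
    and TP: "\<And>x. T (P x) = Q (T x)"
  shows "T (op_sqrt P x) = op_sqrt Q (T x)"
proof -
  obtain a where a: "a > 0" "\<And>x. norm (P x) \<le> a * norm x"
    using bounded_op_pos_bound[OF positive_op_bounded[OF P]] by blast
  obtain b where b: "b > 0" "\<And>x. norm (Q x) \<le> b * norm x"
    using bounded_op_pos_bound[OF positive_op_bounded[OF Q]] by blast
  \<comment> \<open>A joint bound, permitted because \<open>op_sqrt\<close> does not depend on the
    scale.\<close>
  define c where "c = max a b"
  have c: "c > 0" "\<And>x. norm (P x) \<le> c * norm x" "\<And>x. norm (Q x) \<le> c * norm x"
    unfolding c_def using a(1)
    by (auto intro: order_trans[OF a(2) mult_right_mono] order_trans[OF b(2) mult_right_mono])
  show ?thesis
    unfolding op_sqrt_eq_scaled_sqrt[OF P c(1,2)] op_sqrt_eq_scaled_sqrt[OF Q c(1,3)]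
    using P Q c T TP by (rule scaled_sqrt_intertwine)
qed

section \<open>The absolute value and the mixed Schwarz inequality\<close>

lemma positive_op_adj_comp:
  assumes "bounded_op A"
  shows "positive_op (adj A \<circ> A)"
  unfolding positive_op_def
  by (simp add: bounded_op_comp bounded_op_adj assms cinner_adj_left cinner_self)

lemma positive_op_abs_op: "bounded_op A \<Longrightarrow> positive_op (abs_op A)"
  unfolding abs_op_def by (intro positive_op_op_sqrt positive_op_adj_comp)

lemma abs_op_sq: "bounded_op A \<Longrightarrow> abs_op A (abs_op A x) = adj A (A x)"
  unfolding abs_op_def by (simp add: op_sqrt_sq positive_op_adj_comp)

text \<open>\<open>A\<close> intertwines \<open>adj A \<circ> A\<close> with
  \<open>A \<circ> adj A\<close>, and this passes to the square roots.\<close>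

lemma abs_op_intertwine:
  assumes "bounded_op A"
  shows "A (abs_op A x) = abs_op (adj A) (A x)"
  unfolding abs_op_def
proof (rule op_sqrt_intertwine)
  show "A ((adj A \<circ> A) x) = (adj (adj A) \<circ> adj A) (A x)" for x
    by (simp add: assms adj_adj)
qed (intro positive_op_adj_comp bounded_op_adj assms)+

text \<open>Both squared norms equal the form of \<open>adj A \<circ> A\<close> at \<open>x\<close>.
  In particular \<open>A\<close> and \<open>abs_op A\<close> have the same kernel.\<close>

lemma norm_abs_op:
  assumes "bounded_op A"
  shows "norm (abs_op A x) = norm (A x)"
proof -
  have "cinner (abs_op A x) (abs_op A x) = cinner (A x) (A x)"
    by (simp add: positive_op_sym[OF positive_op_abs_op[OF assms]] abs_op_sq assms
        cinner_adj_right)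
  then show ?thesis by (simp add: norm_eq_sqrt_cinner)
qed

text \<open>For \<open>x = |A|u + v\<close> with \<open>v\<close> in the kernel of \<open>|A|\<close>, the intertwining relation \<open>A|A| = |A\<^sup>*|A\<close>
  reduces the claim to the Cauchy-Schwarz inequality of the form \<open>\<langle>|A\<^sup>*|\<cdot>, \<cdot>\<rangle>\<close>, because
  \<open>\<langle>|A\<^sup>*|Au, Au\<rangle> = \<langle>|A|x, x\<rangle>\<close>. Such \<open>x\<close> are dense.\<close>

lemma mixed_Schwarz:
  fixes A :: "'a::chilbert_space \<Rightarrow> 'a"
  assumes A: "bounded_op A"
  shows "(cmod (cinner (A x) y))\<^sup>2
    \<le> Re (cinner (abs_op A x) x) * Re (cinner (abs_op (adj A) y) y)"
proof -
  define P where "P = abs_op A"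
  define Q where "Q = abs_op (adj A)"
  have P: "positive_op P" and Q: "positive_op Q"
    unfolding P_def Q_def by (simp_all add: positive_op_abs_op A bounded_op_adj)
  note linA = bounded_op_clinear[OF A] and linP = positive_op_clinear[OF P]
  note blA = bounded_op_bounded_linear[OF A]
    and blP = bounded_op_bounded_linear[OF positive_op_bounded[OF P]]
  have on_sum: "(cmod (cinner (A (P u + v)) y))\<^sup>2
      \<le> Re (cinner (P (P u + v)) (P u + v)) * Re (cinner (Q y) y)" if v: "P v = 0" for u v
  proof -
    have Av: "A v = 0" using norm_abs_op[OF A, of v] v unfolding P_def by simp
    have AP: "A (P u) = Q (A u)"
      unfolding P_def Q_def by (rule abs_op_intertwine[OF A])
    have "cinner (Q (A u)) (A u) = cinner (P u) (P (P u))"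
      unfolding AP[symmetric] cinner_adj_right[OF A] by (simp add: P_def abs_op_sq A)
    also have "\<dots> = cinner (P (P u + v)) (P u + v)"
      by (simp add: clinear_op_add[OF linP] v cinner_add_right positive_op_sym[OF P])
    finally show ?thesis
      using positive_op_Cauchy_Schwarz[OF Q, of "A u" y]
      by (simp add: clinear_op_add[OF linA] Av AP)
  qed
  define M where "M = closure (range P)"
  \<comment> \<open>One limit argument for both addition and scaling; for scaling, \<open>f\<close>
    ignores its second argument.\<close>
  have subspace_closure: "f a b \<in> M" if ab: "a \<in> M" "b \<in> M"
    and f: "\<And>s t S T. s \<longlonglongrightarrow> S \<Longrightarrow> t \<longlonglongrightarrow> T \<Longrightarrow> (\<lambda>n. f (s n) (t n)) \<longlonglongrightarrow> f S T"
    and range: "\<And>a b. f (P a) (P b) \<in> range P" for f :: "'a \<Rightarrow> 'a \<Rightarrow> 'a" and a b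
  proof -
    obtain s where s: "\<And>n. s n \<in> range P" "s \<longlonglongrightarrow> a"
      using ab(1) unfolding M_def closure_sequential by blast
    obtain t where t: "\<And>n. t n \<in> range P" "t \<longlonglongrightarrow> b"
      using ab(2) unfolding M_def closure_sequential by blast
    have "f (s n) (t n) \<in> range P" for n
      using s(1)[of n] t(1)[of n] range by force
    moreover have "(\<lambda>n. f (s n) (t n)) \<longlonglongrightarrow> f a b"
      using s(2) t(2) by (rule f)
    ultimately show ?thesis
      unfolding M_def closure_sequential by (intro exI[of _ "\<lambda>n. f (s n) (t n)"]) simp
  qed
  have bl_scaleC: "bounded_linear (scaleC c :: 'a \<Rightarrow> 'a)" for c
    by (rule bounded_linear_intro[of _ "cmod c"])
      (simp_all add: scaleC_add_right scaleR_scaleC scaleC_scaleC norm_scaleC mult.commute)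
  obtain m where m: "m \<in> M" and orth: "\<And>u. u \<in> M \<Longrightarrow> cinner (x - m) u = 0"
  proof (rule orthogonal_decomposition[of M x])
    show "closed M" by (simp add: M_def)
    have "P 0 = 0" using clinear_op_diff[OF linP, of 0 0] by simp
    then have "0 \<in> range P" by (metis rangeI)
    then show "0 \<in> M" unfolding M_def by (rule closure_subset[THEN subsetD])
    show "u + v \<in> M" if "u \<in> M" "v \<in> M" for u v
      using that
    proof (rule subspace_closure[of u v "(+)"])
      show "P a + P b \<in> range P" for a b
        unfolding clinear_op_add[OF linP, symmetric] by (rule rangeI)
    qed (rule tendsto_add)
    show "scaleC c u \<in> M" if "u \<in> M" for c u
      using that that
    proof (rule subspace_closure[of u u "\<lambda>a b. scaleC c a"])
      show "scaleC c (P a) \<in> range P" for a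
        unfolding clinear_op_scaleC[OF linP, symmetric] by (rule rangeI)
    qed (rule bounded_linear.tendsto[OF bl_scaleC])
  qed blast
  define v where "v = x - m"
  have "P v = 0"
  proof -
    \<comment> \<open>\<open>v\<close> is orthogonal to the range of \<open>P\<close>; choosing the
      range element \<open>P (P v)\<close> makes this the squared norm of
      \<open>P v\<close>.\<close>
    have "cinner v (P (P v)) = 0"
      unfolding v_def by (rule orth) (auto simp: M_def intro: closure_subset[THEN subsetD])
    then show ?thesis
      using cinner_self_eq_zero[of "P v"] by (simp add: positive_op_sym[OF P])
  qed
  obtain s where s: "\<And>n. s n \<in> range P" and lim: "s \<longlonglongrightarrow> m"
    using m unfolding M_def closure_sequential by blast
  have lim': "(\<lambda>n. s n + v) \<longlonglongrightarrow> x"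
    using tendsto_add[OF lim tendsto_const[of v]] by (simp add: v_def)
  \<comment> \<open>Each \<open>s n + v\<close> has the form \<open>P u + v\<close> treated above,
    so the inequality passes to the limit by continuity.\<close>
  have "(cmod (cinner (A x) y))\<^sup>2 \<le> Re (cinner (P x) x) * Re (cinner (Q y) y)"
  proof (rule tendsto_le)
    show "(\<lambda>n. (cmod (cinner (A (s n + v)) y))\<^sup>2) \<longlonglongrightarrow> (cmod (cinner (A x) y))\<^sup>2"
      by (intro tendsto_intros tendsto_cinner bounded_linear.tendsto[OF blA] lim')
    show "(\<lambda>n. Re (cinner (P (s n + v)) (s n + v)) * Re (cinner (Q y) y))
        \<longlonglongrightarrow> Re (cinner (P x) x) * Re (cinner (Q y) y)"
      by (intro tendsto_intros tendsto_cinner bounded_linear.tendsto[OF blP] lim')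
    show "\<forall>\<^sub>F n in sequentially. (cmod (cinner (A (s n + v)) y))\<^sup>2
        \<le> Re (cinner (P (s n + v)) (s n + v)) * Re (cinner (Q y) y)"
      using s on_sum[OF \<open>P v = 0\<close>] by (intro always_eventually allI) (metis imageE)
  qed simp
  then show ?thesis by (simp add: P_def Q_def)
qed

section \<open>The numerical radius bound\<close>

text \<open>A real \<open>Sup\<close> dominates its elements only for sets bounded above.\<close>

lemma numrad_bdd_above:
  assumes T: "bounded_op T"
  shows "bdd_above (insert 0 {cmod (cinner (T x) x) | x. norm x = 1})"
proof -
  obtain K where K: "K > 0" "\<And>x. norm (T x) \<le> K * norm x"
    using bounded_op_pos_bound[OF T] by blast
  have "cmod (cinner (T x) x) \<le> K" if "norm x = 1" for x
    using cinner_Cauchy_Schwarz[of "T x" x] K(2)[of x] that by simp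
  then show ?thesis using K(1) by (intro bdd_aboveI[of _ K]) auto
qed

lemma numrad_nonneg: "bounded_op T \<Longrightarrow> 0 \<le> numrad T"
  unfolding numrad_def by (intro cSup_upper numrad_bdd_above) auto

lemma cmod_cinner_le_numrad:
  assumes T: "bounded_op T"
  shows "cmod (cinner (T x) x) \<le> numrad T * (norm x)\<^sup>2"
proof (cases "x = 0")
  case False
  define u where "u = (1 / norm x) *\<^sub>R x"
  have "norm u = 1" using False by (simp add: u_def)
  then have "cmod (cinner (T u) u) \<le> numrad T"
    unfolding numrad_def by (intro cSup_upper numrad_bdd_above T) blast
  moreover have "cinner (T u) u = of_real ((1 / norm x)\<^sup>2) * cinner (T x) x"
    by (simp add: u_def clinear_op_scaleR[OF bounded_op_clinear[OF T]] cinner_scaleR_left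
        cinner_scaleR_right power2_eq_square)
  ultimately show ?thesis
    using False by (simp add: norm_mult norm_power norm_divide power_divide field_simps)
qed simp

lemma Re_cinner_le_onorm:
  assumes "bounded_linear T"
  shows "Re (cinner (T x) x) \<le> onorm T * (norm (x :: 'a::complex_inner))\<^sup>2"
proof -
  have "Re (cinner (T x) x) \<le> norm (T x) * norm x"
    using complex_Re_le_cmod cinner_Cauchy_Schwarz order_trans by blast
  also have "\<dots> \<le> onorm T * norm x * norm x"
    by (intro mult_right_mono onorm assms) simp
  finally show ?thesis by (simp add: power2_eq_square mult.assoc)
qed

text \<open>\<open>s\<close> and \<open>t\<close> are convex weights. They will be the squared norms
  of the two components of a unit vector, and this is how both maxima arise.\<close>

lemma max_convex_bound:
  fixes a b s t u v :: real
  assumes "u \<le> a * s" "v \<le> b * t" "0 \<le> s" "0 \<le> t" "s + t = 1"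
  shows "u + v \<le> max a b"
proof -
  have "u \<le> max a b * s" "v \<le> max a b * t"
    using assms(1-4) mult_right_mono[of a "max a b" s] mult_right_mono[of b "max a b" t] by auto
  then have "u + v \<le> max a b * (s + t)" by (simp add: distrib_left)
  then show ?thesis by (simp add: assms(5))
qed

lemma bounded_linear_abs_op_sq_add:
  assumes "bounded_op A" "bounded_op B"
  shows "bounded_linear (\<lambda>x. abs_op A (abs_op A x) + abs_op B (abs_op B x))"
proof -
  have bl: "bounded_linear (abs_op A)" "bounded_linear (abs_op B)"
    by (intro bounded_op_bounded_linear positive_op_bounded positive_op_abs_op assms)+
  show ?thesis
    by (intro bounded_linear_add bounded_linear_compose[OF bl(1) bl(1)]
        bounded_linear_compose[OF bl(2) bl(2)])
qed

lemma off_diagonal_form_bound: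
  fixes B C :: "'a::chilbert_space \<Rightarrow> 'a"
  assumes B: "bounded_op B" and C: "bounded_op C" and unit: "(norm x1)\<^sup>2 + (norm x2)\<^sup>2 = 1"
  shows "(cmod (cinner (B x2) x1 + cinner (C x1) x2))\<^sup>2
    \<le> 1/4 * max (onorm (\<lambda>x. abs_op B (abs_op B x) + abs_op (adj C) (abs_op (adj C) x)))
                 (onorm (\<lambda>x. abs_op (adj B) (abs_op (adj B) x) + abs_op C (abs_op C x)))
      + 1/2 * max (numrad (abs_op B \<circ> abs_op (adj C))) (numrad (abs_op C \<circ> abs_op (adj B)))"
    (is "_ \<le> 1/4 * max (onorm ?U) (onorm ?V) + 1/2 * ?W")
proof -
  define P where "P = abs_op B"
  define P' where "P' = abs_op (adj B)"
  define Q where "Q = abs_op C"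
  define Q' where "Q' = abs_op (adj C)"
  have pos: "positive_op P" "positive_op P'" "positive_op Q" "positive_op Q'"
    unfolding P_def P'_def Q_def Q'_def
    by (simp_all add: positive_op_abs_op bounded_op_adj B C)
  note bd = pos[THEN positive_op_bounded]
  note sym = pos[THEN positive_op_sym]
  define e where "e = (x1, x2)"
  \<comment> \<open>\<open>a\<close> and \<open>b\<close> are the images of \<open>e\<close> under
    the absolute values of the off-diagonal matrix and of its adjoint.\<close>
  define a where "a = (Q x1, P x2)"
  define b where "b = (P' x1, Q' x2)"
  have e: "norm e = 1" using unit by (simp add: e_def norm_prod_def)
  have norm_sq: "(norm (u, v))\<^sup>2 = (norm u)\<^sup>2 + (norm v)\<^sup>2" for u v :: 'a
    by (simp add: norm_prod_def)
  define p where "p = Re (cinner (P x2) x2)"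
  define p' where "p' = Re (cinner (P' x1) x1)"
  define q where "q = Re (cinner (Q x1) x1)"
  define q' where "q' = Re (cinner (Q' x2) x2)"
  have nn: "0 \<le> p" "0 \<le> p'" "0 \<le> q" "0 \<le> q'"
    unfolding p_def p'_def q_def q'_def by (simp_all add: positive_op_nonneg pos)
  have ab: "cinner a e = of_real (q + p)" "cinner e b = of_real (p' + q')"
    using pos
    by (simp_all add: a_def b_def e_def cinner_prod_def p_def p'_def q_def q'_def complex_eq_iff
        positive_op_def flip: sym)
  have "cmod (cinner (B x2) x1) \<le> sqrt (p * p')"
    unfolding p_def p'_def P_def P'_def by (rule real_le_rsqrt) (rule mixed_Schwarz[OF B])
  moreover have "cmod (cinner (C x1) x2) \<le> sqrt (q * q')"
    unfolding q_def q'_def Q_def Q'_def by (rule real_le_rsqrt) (rule mixed_Schwarz[OF C])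
  ultimately have "cmod (cinner (B x2) x1 + cinner (C x1) x2) \<le> sqrt (p * p') + sqrt (q * q')"
    using norm_triangle_ineq[of "cinner (B x2) x1" "cinner (C x1) x2"] by linarith
  then have "(cmod (cinner (B x2) x1 + cinner (C x1) x2))\<^sup>2 \<le> (sqrt (p * p') + sqrt (q * q'))\<^sup>2"
    by (intro power_mono) auto
  \<comment> \<open>The cross term is regrouped so that the arithmetic-geometric mean inequality
    yields \<open>p * q' + q * p'\<close>, the terms missing from the product.\<close>
  also have "\<dots> = p * p' + q * q' + 2 * (sqrt (p * q') * sqrt (q * p'))"
    using nn by (simp add: power2_sum real_sqrt_mult power_mult_distrib)
  also have "\<dots> \<le> (q + p) * (p' + q')"
    using nn sum_squares_bound[of "sqrt (p * q')" "sqrt (q * p')"] by (simp add: algebra_simps)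
  also have "\<dots> = cmod (cinner a e * cinner e b)"
    unfolding ab using nn by (simp flip: of_real_mult of_real_add)
  also have "\<dots> \<le> (norm a * norm b + cmod (cinner a b)) / 2"
    using e by (rule Buzano_inequality)
  also have "\<dots> \<le> 1/4 * ((norm a)\<^sup>2 + (norm b)\<^sup>2) + 1/2 * cmod (cinner a b)"
    using sum_squares_bound[of "norm a" "norm b"] by (simp add: add_divide_distrib)
  also have "\<dots> \<le> 1/4 * max (onorm ?U) (onorm ?V) + 1/2 * ?W"
  proof (intro add_mono mult_left_mono)
    have U: "bounded_linear ?U" and V: "bounded_linear ?V"
      by (intro bounded_linear_abs_op_sq_add bounded_op_adj B C)+
    \<comment> \<open>The four squared norms in \<open>a\<close> and \<open>b\<close> are regrouped
      by the vector they act on: \<open>x2\<close> yields \<open>?U\<close> and \<open>x1\<close>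
      yields \<open>?V\<close>.\<close>
    have "Re (cinner (?U x2) x2) = (norm (P x2))\<^sup>2 + (norm (Q' x2))\<^sup>2"
      unfolding P_def[symmetric] Q'_def[symmetric] cinner_add_left sym(1)[of "P x2"] sym(4)[of "Q' x2"]
      by (simp add: cinner_self)
    moreover have "Re (cinner (?V x1) x1) = (norm (P' x1))\<^sup>2 + (norm (Q x1))\<^sup>2"
      unfolding P'_def[symmetric] Q_def[symmetric] cinner_add_left sym(2)[of "P' x1"] sym(3)[of "Q x1"]
      by (simp add: cinner_self)
    ultimately show "(norm a)\<^sup>2 + (norm b)\<^sup>2 \<le> max (onorm ?U) (onorm ?V)"
      using max_convex_bound[OF Re_cinner_le_onorm[OF U] Re_cinner_le_onorm[OF V], of x2 x1] unit
      by (simp add: a_def b_def norm_sq)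
    \<comment> \<open>Symmetry of \<open>S\<close> gives the composition up to conjugation, which
      the modulus does not see.\<close>
    have swap: "cmod (cinner (S z) (T z)) = cmod (cinner ((S \<circ> T) z) z)"
      if "positive_op S" for S T :: "'a \<Rightarrow> 'a" and z
      using cinner_commute[of "S z" "T z"] positive_op_sym[OF that, of "T z" z]
      by simp
    have "cmod (cinner a b) \<le> cmod (cinner (P x2) (Q' x2)) + cmod (cinner (Q x1) (P' x1))"
      using norm_triangle_ineq by (simp add: a_def b_def cinner_prod_def add.commute)
    also have "\<dots> \<le> ?W"
      unfolding swap[OF pos(1)] swap[OF pos(3)]
        P_def[symmetric] P'_def[symmetric] Q_def[symmetric] Q'_def[symmetric]
      using unit
      by (intro max_convex_bound[of _ _ "(norm x2)\<^sup>2" _ _ "(norm x1)\<^sup>2"] cmod_cinner_le_numrad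
          bounded_op_comp bd) auto
    finally show "cmod (cinner a b) \<le> ?W" .
  qed auto
  finally show ?thesis .
qed

theorem mainTheorem3:
  fixes B C :: "'a::chilbert_space \<Rightarrow> 'a"
  assumes "bounded_op B" and "bounded_op C"
  shows "(numrad_block (\<lambda>_. 0) B C (\<lambda>_. 0))\<^sup>2
    \<le> 1/4 * max (onorm (\<lambda>x. abs_op B (abs_op B x) + abs_op (adj C) (abs_op (adj C) x)))
                 (onorm (\<lambda>x. abs_op (adj B) (abs_op (adj B) x) + abs_op C (abs_op C x)))
      + 1/2 * max (numrad (abs_op B \<circ> abs_op (adj C))) (numrad (abs_op C \<circ> abs_op (adj B)))"
    (is "_ \<le> 1/4 * max ?m1 ?m2 + 1/2 * max ?w1 ?w2")
proof -
  define R where "R = 1/4 * max ?m1 ?m2 + 1/2 * max ?w1 ?w2"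
  have "0 \<le> ?m1"
    by (intro onorm_pos_le bounded_linear_abs_op_sq_add bounded_op_adj assms)
  moreover have "0 \<le> ?w1"
    by (intro numrad_nonneg bounded_op_comp positive_op_bounded positive_op_abs_op bounded_op_adj
        assms)
  \<comment> \<open>Needed for the inserted \<open>0\<close> in the supremum and for
    \<open>(sqrt R)\<^sup>2 = R\<close>.\<close>
  ultimately have R: "0 \<le> R" unfolding R_def by (simp add: le_max_iff_disj)
  define N where "N = insert 0
     {cmod (cinner (0 + B x2) x1 + cinner (C x1 + 0) x2) | x1 x2. (norm x1)\<^sup>2 + (norm x2)\<^sup>2 = 1}"
  have bound: "r \<le> sqrt R" if "r \<in> N" for r
    using that R off_diagonal_form_bound[OF assms] unfolding N_def R_def
    by (auto intro!: real_le_rsqrt)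
  have block: "numrad_block (\<lambda>_. 0) B C (\<lambda>_. 0) = Sup N"
    unfolding numrad_block_def N_def ..
  have "Sup N \<le> sqrt R"
    by (rule cSup_least) (use bound in \<open>auto simp: N_def\<close>)
  \<comment> \<open>The inserted \<open>0\<close> gives the sign under which squaring preserves the
    bound.\<close>
  moreover have "0 \<le> Sup N"
    by (rule cSup_upper) (use bound in \<open>auto simp: N_def intro!: bdd_aboveI[of _ "sqrt R"]\<close>)
  ultimately have "(Sup N)\<^sup>2 \<le> (sqrt R)\<^sup>2" by (rule power_mono)
  then show ?thesis using R by (simp add: block R_def)
qed

end
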